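(* Let $X$ be a (short, normal-play) combinatorial game. Then $X$ is a conflict placement game if and only if there exists a Digraph placement game $G$ with the same literal form as $X$ (i.e. $G \cong X$).
   Context: All games are short normal-play two-player combinatorial games between Left and Right: no chance or hidden information, every play ends after a bounded number of moves, each position has finitely many options, and a player who cannot move on their turn loses. A game is written $X=\{Y_1,\dots,Y_k \mid Z_1,\dots,Z_t\}$ where the $Y_i$ are its Left options and the $Z_j$ its Right options. Two games have the same literal form, $X\cong X'$, if (recursively) their Left options and Right options correspond with identical literal forms; $0\cong\{\mid\}$. Digraph placement: given a finite digraph $G=(V,E)$ with a (not necessarily proper) colouring $\phi:V\to\{\text{blue},\text{red}\}$, the game played on $G$ is: on her turn Left chooses a remaining blue vertex $v$ and deletes the closed out-neighbourhood $N^+[v]$ (i.e. $v$ and all its out-neighbours); on his turn Right chooses a remaining red vertex $u$ and deletes $N^+[u]$. A player who cannot move loses. Placement game: a game that starts with an empty board, a move places pieces on part of the board subject to the rules, any piece legally placeable at a position was also legally placeable there at any earlier time, and placed pieces are never moved or removed. The moves of a placement game $X$ are recorded as triples $(x,T,p)$ ($T$ the piece type, $x$ its location, $p\in\{\text{Left},\text{Right}\}$ the player who may make it; if both players may place $T$ at $x$, two triples are recorded); $M(X)$ denotes this set of triples. A placement game $X$ is a conflict placement game if for every move $(x,T,p)\in M(X)$ there is a set $A_{x,T,p}\subseteq M(X)$ (its conflict set) such that $(x,T,p)$ is a legal move in a follower $Y$ of $X$ if and only if $Y$ is obtained from $X$ by a sequence of legal moves $(x_1,T_1,p_1),\dots,(x_n,T_n,p_n)$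 with $A_{x,T,p}\cap\{(x_1,T_1,p_1),\dots,(x_n,T_n,p_n)\}=\emptyset$. *)

theory Defs
  imports
    "HOL-Library.FSet"
    "HOL-Library.Infinite_Typeclass"
    "Graph_Theory.Graph_Theory"
begin

section \<open>Short games and literal forms\<close>

datatype player = Left | Right

text \<open>
  A value of type \<open>game\<close> is a literal form: options are finite sets of literal forms, so HOL
  equality on this type is identity of literal forms.
\<close>

datatype game = Game (lefts: "game fset") (rights: "game fset")

text \<open>
  \<open>opts p s\<close> is the set of positions to which player \<open>p\<close> can move from the position \<open>s\<close> of
  some ruleset. \<open>same_literal_form opts s X\<close> says that \<open>s\<close>, as a game, is identical in form to \<open>X\<close>.
  The relator \<open>rel_set\<close> demands that every option on either side has a counterpart on the other;
  different moves may thus lead to options of the same form.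
\<close>

inductive same_literal_form :: "(player \<Rightarrow> 's \<Rightarrow> 's set) \<Rightarrow> 's \<Rightarrow> game \<Rightarrow> bool"
  for opts :: "player \<Rightarrow> 's \<Rightarrow> 's set" where
  "rel_set (same_literal_form opts) (opts Left s) (fset XL) \<Longrightarrow>
   rel_set (same_literal_form opts) (opts Right s) (fset XR) \<Longrightarrow>
   same_literal_form opts s (Game XL XR)"
monos rel_set_mono


section \<open>Digraph placement\<close>

datatype colour = Blue | Red

fun colour_of :: "player \<Rightarrow> colour" where
  "colour_of Left = Blue"
| "colour_of Right = Red"

definition closed_out_nbhd :: "('v, 'a) pre_digraph \<Rightarrow> 'v \<Rightarrow> 'v set" where
  "closed_out_nbhd G v = insert v {w. v \<rightarrow>\<^bsub>G\<^esub> w}"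

text \<open>Positions are the remaining digraphs; the neighbourhood is taken in the remaining digraph.\<close>

definition digraph_opts ::
  "('v \<Rightarrow> colour) \<Rightarrow> player \<Rightarrow> ('v, 'a) pre_digraph \<Rightarrow> ('v, 'a) pre_digraph set" where
  "digraph_opts \<phi> p G =
     {G \<restriction> (verts G - closed_out_nbhd G v) | v. v \<in> verts G \<and> \<phi> v = colour_of p}"


section \<open>Placement games\<close>

text \<open>
  A move is a triple of a location, a piece type and the player who may make it. A position is the
  set of moves made so far, i.e. the board together with a record of who placed which piece; the
  empty board is \<open>{}\<close>, and nothing is ever moved or removed. A ruleset gives the legal moves of
  both players in each position; its values at unreachable positions are irrelevant.
\<close>

type_synonym ('l, 't) move = "'l \<times> 't \<times> player"
type_synonym ('l, 't) position = "('l, 't) move set"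
type_synonym ('l, 't) ruleset = "('l, 't) position \<Rightarrow> ('l, 't) move set"

text \<open>
  \<open>leads R Y ms Z\<close>: the sequence \<open>ms\<close> of legal moves, not necessarily alternating between the
  players, leads from \<open>Y\<close> to \<open>Z\<close>.
\<close>

inductive leads ::
  "('l, 't) ruleset \<Rightarrow> ('l, 't) position \<Rightarrow> ('l, 't) move list \<Rightarrow> ('l, 't) position \<Rightarrow> bool"
  for R :: "('l, 't) ruleset" where
  "leads R Y [] Y"
| "m \<in> R Y \<Longrightarrow> leads R (insert m Y) ms Z \<Longrightarrow> leads R Y (m # ms) Z"

definition follower :: "('l, 't) ruleset \<Rightarrow> ('l, 't) position \<Rightarrow> bool" where
  "follower R Y \<longleftrightarrow> (\<exists>ms. leads R {} ms Y)"

definition short :: "('l, 't) ruleset \<Rightarrow> bool" where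
  "short R \<longleftrightarrow>
     (\<forall>Y. follower R Y \<longrightarrow> finite (R Y)) \<and>
     (\<exists>N. \<forall>ms Y. leads R {} ms Y \<longrightarrow> length ms \<le> N)"

definition placement_game :: "('l, 't) ruleset \<Rightarrow> bool" where
  "placement_game R \<longleftrightarrow>
     short R \<and> (\<forall>Y ms Z. follower R Y \<and> leads R Y ms Z \<longrightarrow> R Z \<subseteq> R Y)"

definition moves :: "('l, 't) ruleset \<Rightarrow> ('l, 't) move set" where
  "moves R = (\<Union>Y \<in> {Y. follower R Y}. R Y)"

definition conflict_placement_game :: "('l, 't) ruleset \<Rightarrow> bool" where
  "conflict_placement_game R \<longleftrightarrow>
     placement_game R \<and>
     (\<forall>m \<in> moves R. \<exists>A \<subseteq> moves R. \<forall>Y. follower R Y \<longrightarrow>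
        (m \<in> R Y \<longleftrightarrow> (\<exists>ms. leads R {} ms Y \<and> A \<inter> set ms = {})))"

definition placement_opts ::
  "('l, 't) ruleset \<Rightarrow> player \<Rightarrow> ('l, 't) position \<Rightarrow> ('l, 't) position set" where
  "placement_opts R p Y = {insert (x, T, p) Y | x T. (x, T, p) \<in> R Y}"

end

theory Submission
  imports Defs
begin

text \<open>
  No move of a short placement game can be repeated, so every move belongs to its own conflict set,
  and a move is legal in a follower iff its conflict set is disjoint from the moves made so far.
  Hence making the move \<open>m\<close> removes exactly the remaining moves whose conflict set contains \<open>m\<close>.
  This is Digraph placement on the set of moves, with an arc from \<open>m\<close> to another move \<open>m'\<close> whenever \<open>m\<close>
  lies in the conflict set of \<open>m'\<close>. Conversely, the vertices of a digraph serve as moves, the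
  conflict set of a vertex being its closed in-neighbourhood.
\<close>

section \<open>Literal forms under bisimulation\<close>

text \<open>Induction on the derivation for \<open>s\<close>: \<open>B\<close> matches the options
  of \<open>t\<close> with those of \<open>s\<close>, and the induction hypothesis transports the
  forms of the latter. Forms are thus compared across two rulesets without any map between their
  positions.\<close>

lemma same_literal_form_bisim:
  assumes "same_literal_form opts s X" and "B s t"
    and bisim: "\<And>p s t. B s t \<Longrightarrow> rel_set B (opts p s) (opts' p t)"
  shows "same_literal_form opts' t X"
  using assms(1,2)
proof (induction arbitrary: t rule: same_literal_form.induct)
  case (1 s XL XR)
  have "rel_set (same_literal_form opts') (opts' p t) Z"
    if "rel_set (\<lambda>s X. same_literal_form opts s X \<and> (\<forall>t. B s t \<longrightarrow> same_literal_form opts' t X))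
          (opts p s) Z" for p Z
    using that bisim[OF 1(3), of p] unfolding rel_set_def by meson
  then show ?case
    using 1(1,2) by (intro same_literal_form.intros) blast+
qed


section \<open>Induced subdigraphs\<close>

lemma induce_subgraph_induce_subgraph:
  "T \<subseteq> S \<Longrightarrow> (G \<restriction> S) \<restriction> T = G \<restriction> T"
  by (auto simp: induce_subgraph_def)

lemma (in wf_digraph) induce_subgraph_all_verts: "G \<restriction> verts G = G"
  by (auto simp: induce_subgraph_def intro!: pre_digraph.equality)

text \<open>Inducing on \<open>S\<close> loses only arcs with an end outside \<open>S\<close>, so
  deletion never changes which remaining vertices a remaining vertex points to.\<close>

lemma closed_out_nbhd_induce_subgraph:
  assumes "v \<in> S"
  shows "closed_out_nbhd (G \<restriction> S) v \<inter> S = closed_out_nbhd G v \<inter> S"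
  using assms
  by (auto simp: closed_out_nbhd_def induce_subgraph_def arcs_ends_def arc_to_ends_def)

text \<open>Every position reached is induced by a vertex set, so play can be followed on vertex
  sets alone, with neighbourhoods computed once in the original \<open>G\<close>.\<close>

lemma digraph_opts_induce_subgraph:
  "digraph_opts \<phi> p (G \<restriction> S) =
     {G \<restriction> (S - closed_out_nbhd G v) | v. v \<in> S \<and> \<phi> v = colour_of p}"
proof -
  have "(G \<restriction> S) \<restriction> (S - closed_out_nbhd (G \<restriction> S) v) = G \<restriction> (S - closed_out_nbhd G v)"
    if "v \<in> S" for v
  proof -
    have "S - closed_out_nbhd (G \<restriction> S) v = S - closed_out_nbhd G v"
      using closed_out_nbhd_induce_subgraph[OF that, of G] by blast
    then show ?thesis
      by (simp add: induce_subgraph_induce_subgraph)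
  qed
  then show ?thesis
    unfolding digraph_opts_def induce_subgraph_verts by (intro Collect_cong ex_cong1) auto
qed


section \<open>Sequences of moves\<close>

lemma leads_position: "leads R Y ms Z \<Longrightarrow> Z = Y \<union> set ms"
  by (induction rule: leads.induct) auto

lemma leads_append: "leads R Y ms Z \<Longrightarrow> leads R Z ms' W \<Longrightarrow> leads R Y (ms @ ms') W"
  by (induction rule: leads.induct) (auto intro: leads.intros)

lemma leads_singleton: "m \<in> R Y \<Longrightarrow> leads R Y [m] (insert m Y)"
  by (intro leads.intros)

lemma follower_empty: "follower R {}"
  unfolding follower_def by (blast intro: leads.intros)

lemma follower_insert: "follower R Y \<Longrightarrow> m \<in> R Y \<Longrightarrow> follower R (insert m Y)"
  unfolding follower_def by (blast intro: leads_append leads_singleton)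

text \<open>A position is the set of moves made, so all sequences from \<open>{}\<close> to
  \<open>Y\<close> have the same underlying set, and the choice of sequence in the conflict
  condition disappears.\<close>

lemma follower_disjoint_iff:
  assumes "follower R Y"
  shows "(\<exists>ms. leads R {} ms Y \<and> A \<inter> set ms = {}) \<longleftrightarrow> A \<inter> Y = {}"
  using assms leads_position[of R "{}" _ Y] unfolding follower_def by auto

lemma placement_game_mono:
  "placement_game R \<Longrightarrow> follower R Y \<Longrightarrow> leads R Y ms Z \<Longrightarrow> R Z \<subseteq> R Y"
  unfolding placement_game_def by blast

lemma placement_game_initial:
  assumes "placement_game R" and "follower R Y"
  shows "R Y \<subseteq> R {}"
  using assms placement_game_mono[OF _ follower_empty] unfolding follower_def by blast

lemma moves_placement_game:
  assumes "placement_game R"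
  shows "moves R = R {}"
  using placement_game_initial[OF assms] follower_empty unfolding moves_def by blast

lemma short_finite: "short R \<Longrightarrow> finite (R {})"
  using follower_empty unfolding short_def by blast

text \<open>Replaying a move already in \<open>Y\<close> leaves the position unchanged, so it could
  be repeated beyond any bound on the length of play.\<close>

lemma short_not_repeat:
  assumes "short R" and "follower R Y" and "m \<in> R Y"
  shows "m \<notin> Y"
proof
  assume "m \<in> Y"
  have rep: "leads R Y (replicate n m) Y" for n
    using \<open>m \<in> R Y\<close> \<open>m \<in> Y\<close>
    by (induction n) (auto intro!: leads.intros simp: insert_absorb)
  obtain ms where "leads R {} ms Y"
    using assms(2) unfolding follower_def by blast
  then have "leads R {} (ms @ replicate n m) Y" for n
    by (rule leads_append[OF _ rep])
  moreover obtain N where "\<And>ms Y. leads R {} ms Y \<Longrightarrow> length ms \<le> N"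
    using assms(1) unfolding short_def by blast
  ultimately have "length (ms @ replicate (Suc N) m) \<le> N"
    by blast
  then show False
    by simp
qed

lemma leads_distinct:
  assumes "\<And>Y. R Y \<inter> Y = {}" and "leads R Y ms Z"
  shows "distinct ms \<and> set ms \<inter> Y = {}"
  using assms(2)
proof (induction rule: leads.induct)
  case (2 m Y ms Z)
  then show ?case
    using assms(1)[of Y] by auto
qed simp

text \<open>The moves of a play are distinct and all come from \<open>R {}\<close>, which bounds its
  length by \<open>card (R {})\<close>. Antitonicity gives the persistence condition, since
  positions only grow.\<close>

lemma antimono_placement_game:
  assumes "antimono R" and disjoint: "\<And>Y. R Y \<inter> Y = {}" and fin: "finite (R {})"
  shows "placement_game R"
proof -
  have sub: "R Z \<subseteq> R Y" if "Y \<subseteq> Z" for Y Z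
    using antimonoD[OF assms(1) that] .
  have within: "set ms \<subseteq> R {}" if "leads R Y ms Z" for Y ms Z
    using that by (induction rule: leads.induct) (use sub[of "{}"] in auto)
  have "length ms \<le> card (R {})" if "leads R {} ms Y" for ms Y
    using leads_distinct[OF disjoint that] within[OF that] card_mono[OF fin]
    by (metis distinct_card)
  then have "short R"
    unfolding short_def using finite_subset[OF sub fin] by blast
  moreover have "R Z \<subseteq> R Y" if "leads R Y ms Z" for Y ms Z
    using sub leads_position[OF that] by blast
  ultimately show ?thesis
    unfolding placement_game_def by blast
qed


section \<open>Conflict placement games and digraphs\<close>

lemma conflict_placement_game_sets:
  assumes "conflict_placement_game R"
  obtains A where "\<And>Y m. follower R Y \<Longrightarrow> m \<in> R {} \<Longrightarrow> m \<in> R Y \<longleftrightarrow> A m \<inter> Y = {}"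
    and "\<And>m. m \<in> R {} \<Longrightarrow> m \<in> A m"
proof -
  have pg: "placement_game R"
    using assms unfolding conflict_placement_game_def by blast
  have "\<forall>m \<in> R {}. \<exists>A. \<forall>Y. follower R Y \<longrightarrow> (m \<in> R Y \<longleftrightarrow> A \<inter> Y = {})"
    using assms unfolding conflict_placement_game_def moves_placement_game[OF pg]
    by (metis follower_disjoint_iff)
  then obtain A where A: "\<And>Y m. follower R Y \<Longrightarrow> m \<in> R {} \<Longrightarrow> m \<in> R Y \<longleftrightarrow> A m \<inter> Y = {}"
    by metis
  \<comment> \<open>The position \<open>{m}\<close> is a follower in which \<open>m\<close> is no
    longer legal, so the conflict set of \<open>m\<close> must meet \<open>{m}\<close>.\<close>
  moreover have "m \<in> A m" if "m \<in> R {}" for m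
  proof -
    have fol: "follower R {m}"
      using follower_insert[of R "{}" m] follower_empty that by blast
    have "short R"
      using pg unfolding placement_game_def by blast
    then have "m \<notin> R {m}"
      using short_not_repeat[OF _ fol] by blast
    then show ?thesis
      using A[OF fol that] by auto
  qed
  ultimately show thesis
    using that by blast
qed

text \<open>The invariant behind both directions of the theorem: \<open>f\<close> sends moves to
  vertices, and the digraph left over is the one induced by the images of the moves still
  legal.\<close>

lemma placement_opts_bisim:
  fixes R :: "('l, 't) ruleset" and G :: "('v, 'a) pre_digraph"
  assumes colour: "\<And>x T p. (x, T, p) \<in> R {} \<Longrightarrow> \<phi> (f (x, T, p)) = colour_of p"
    and initial: "\<And>Y. follower R Y \<Longrightarrow> R Y \<subseteq> R {}"
    and step: "\<And>Y m. follower R Y \<Longrightarrow> m \<in> R Y \<Longrightarrow>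
      f ` R (insert m Y) = f ` R Y - closed_out_nbhd G (f m)"
    and "follower R Y"
  defines "B \<equiv> \<lambda>Y H. follower R Y \<and> H = G \<restriction> f ` R Y"
  shows "rel_set B (placement_opts R p Y) (digraph_opts \<phi> p (G \<restriction> f ` R Y))"
proof (rule rel_setI)
  have succ: "B (insert m Y) (G \<restriction> (f ` R Y - closed_out_nbhd G (f m)))" if "m \<in> R Y" for m
    using that follower_insert[OF assms(4) that] step[OF assms(4) that] unfolding B_def by simp
  {
    fix Z assume "Z \<in> placement_opts R p Y"
    then obtain x T where Z: "Z = insert (x, T, p) Y" "(x, T, p) \<in> R Y"
      unfolding placement_opts_def by blast
    then show "\<exists>H \<in> digraph_opts \<phi> p (G \<restriction> f ` R Y). B Z H"
      using succ[OF Z(2)] colour[of x T p] initial[OF assms(4)]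
      unfolding digraph_opts_induce_subgraph by blast
  next
    fix H assume "H \<in> digraph_opts \<phi> p (G \<restriction> f ` R Y)"
    then obtain m where m: "m \<in> R Y" "\<phi> (f m) = colour_of p"
      "H = G \<restriction> (f ` R Y - closed_out_nbhd G (f m))"
      unfolding digraph_opts_induce_subgraph by blast
    obtain x T q where xTq: "m = (x, T, q)"
      by (cases m)
    \<comment> \<open>A vertex chosen by \<open>p\<close> has the colour of \<open>p\<close>; since
      \<open>colour_of\<close> is injective, the move behind it belongs to \<open>p\<close>.\<close>
    have "colour_of q = colour_of p"
      using m colour[of x T q] initial[OF assms(4)] xTq by auto
    then have "q = p"
      by (cases q; cases p) auto
    then show "\<exists>Z \<in> placement_opts R p Y. B Z H"
      using succ[OF m(1)] m xTq unfolding placement_opts_def by blast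
  }
qed

lemma placement_digraph_same_literal_form:
  fixes R :: "('l, 't) ruleset" and G :: "('v, 'a) pre_digraph"
  assumes "wf_digraph G" and verts: "f ` R {} = verts G"
    and colour: "\<And>x T p. (x, T, p) \<in> R {} \<Longrightarrow> \<phi> (f (x, T, p)) = colour_of p"
    and initial: "\<And>Y. follower R Y \<Longrightarrow> R Y \<subseteq> R {}"
    and step: "\<And>Y m. follower R Y \<Longrightarrow> m \<in> R Y \<Longrightarrow>
      f ` R (insert m Y) = f ` R Y - closed_out_nbhd G (f m)"
  shows "same_literal_form (placement_opts R) {} X \<longleftrightarrow> same_literal_form (digraph_opts \<phi>) G X"
proof -
  define B where "B = (\<lambda>Y H. follower R Y \<and> H = G \<restriction> f ` R Y)"
  have bisim: "rel_set B (placement_opts R p Y) (digraph_opts \<phi> p H)" if "B Y H" for p Y H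
    using that placement_opts_bisim[of R \<phi> f G Y p, OF colour initial step]
    unfolding B_def by blast
  \<comment> \<open>Well-formedness enters here: all arcs end in \<open>verts G\<close>, so inducing
    on every vertex returns \<open>G\<close> itself.\<close>
  have start: "B {} G"
    using follower_empty wf_digraph.induce_subgraph_all_verts[OF assms(1)]
    unfolding B_def verts by simp
  show ?thesis
  proof
    assume "same_literal_form (placement_opts R) {} X"
    then show "same_literal_form (digraph_opts \<phi>) G X"
      using same_literal_form_bisim[where B = B] start bisim by blast
  next
    assume "same_literal_form (digraph_opts \<phi>) G X"
    then show "same_literal_form (placement_opts R) {} X"
      \<comment> \<open>The converse of a bisimulation is again one.\<close>
      using same_literal_form_bisim[where B = "B\<inverse>\<inverse>"] start bisim
      by (metis conversepI conversepD rel_set_conversep)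
  qed
qed

text \<open>This renames finitely many moves or vertices inside whatever infinite type is prescribed
  for vertices or locations.\<close>

lemma finite_inj_on_infinite:
  assumes "finite S"
  obtains f :: "'a \<Rightarrow> 'b :: infinite" where "inj_on f S"
proof -
  obtain T :: "'b set" where "finite T" "card T = card S"
    using infinite_arbitrarily_large[OF infinite_UNIV] by metis
  then obtain f where "bij_betw f S T"
    using finite_same_card_bij[OF assms] by metis
  then show thesis
    using that bij_betw_imp_inj_on by blast
qed

lemma conflict_placement_game_imp_digraph:
  fixes R :: "('l, 't) ruleset"
  assumes "conflict_placement_game R"
  shows "\<exists>(G :: ('v :: infinite) pair_pre_digraph) \<phi>. pair_digraph G \<and>
    (\<forall>X. same_literal_form (placement_opts R) {} X \<longrightarrow>
         same_literal_form (digraph_opts \<phi>) (with_proj G) X)"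
proof -
  have pg: "placement_game R"
    using assms unfolding conflict_placement_game_def by blast
  then have fin: "finite (R {})"
    unfolding placement_game_def by (blast intro: short_finite)
  obtain A where A: "\<And>Y m. follower R Y \<Longrightarrow> m \<in> R {} \<Longrightarrow> m \<in> R Y \<longleftrightarrow> A m \<inter> Y = {}"
    and self: "\<And>m. m \<in> R {} \<Longrightarrow> m \<in> A m"
    using conflict_placement_game_sets[OF assms] by blast
  obtain f :: "('l, 't) move \<Rightarrow> 'v" where inj: "inj_on f (R {})"
    using finite_inj_on_infinite[OF fin] by blast
  \<comment> \<open>Loops are left out because a \<open>pair_digraph\<close> has none; the closed
    neighbourhood puts \<open>m\<close> back, in agreement with \<open>m \<in> A m\<close>.\<close>
  define E where "E = {(m, m'). m \<in> R {} \<and> m' \<in> R {} \<and> m \<noteq> m' \<and> m \<in> A m'}"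
  define G where "G = \<lparr>pverts = f ` R {}, parcs = map_prod f f ` E\<rparr>"
  define \<phi> where "\<phi> = (\<lambda>v. colour_of (snd (snd (inv_into (R {}) f v))))"
  have pd: "pair_digraph G"
  proof
    have "E \<subseteq> R {} \<times> R {}"
      unfolding E_def by blast
    then have "finite E"
      using fin by (meson finite_SigmaI finite_subset)
    then show "finite (parcs G)"
      unfolding G_def by simp
  qed (use fin in \<open>auto simp: G_def E_def dest: inj_onD[OF inj]\<close>)
  have nbhd: "f m' \<in> closed_out_nbhd (with_proj G) (f m) \<longleftrightarrow> m \<in> A m'"
    if "m \<in> R {}" "m' \<in> R {}" for m m'
  proof -
    have "(f m, f m') \<in> map_prod f f ` E \<longleftrightarrow> (m, m') \<in> E"
    proof
      assume "(f m, f m') \<in> map_prod f f ` E"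
      then obtain a b where ab: "(a, b) \<in> E" "f a = f m" "f b = f m'"
        by auto
      then have "a = m" "b = m'"
        using that inj_onD[OF inj] unfolding E_def by blast+
      then show "(m, m') \<in> E"
        using ab by simp
    qed (rule map_prod_imageI)
    moreover have "f m' = f m \<longleftrightarrow> m' = m"
      using inj_on_eq_iff[OF inj that(2,1)] .
    ultimately show ?thesis
      using that self[OF that(1)] by (auto simp: closed_out_nbhd_def G_def E_def)
  qed
  have step: "f ` R (insert m Y) = f ` R Y - closed_out_nbhd (with_proj G) (f m)"
    if "follower R Y" "m \<in> R Y" for Y m
  proof -
    note initial = placement_game_initial[OF pg]
    have fol: "follower R (insert m Y)"
      using follower_insert[OF that] .
    \<comment> \<open>Passing from \<open>Y\<close> to \<open>insert m Y\<close>, the set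
      \<open>A m'\<close> stays disjoint from the position exactly when it does not contain
      \<open>m\<close>.\<close>
    have "m' \<in> R (insert m Y) \<longleftrightarrow> m' \<in> R Y \<and> m \<notin> A m'" if "m' \<in> R {}" for m'
      using A[OF fol that] A[OF \<open>follower R Y\<close> that] by auto
    then have "R (insert m Y) = {m' \<in> R Y. m \<notin> A m'}"
      using initial[OF fol] initial[OF that(1)] by blast
    also have "\<dots> = {m' \<in> R Y. f m' \<notin> closed_out_nbhd (with_proj G) (f m)}"
      using nbhd initial[OF that(1)] that(2) by blast
    finally show ?thesis
      by auto
  qed
  have wf: "wf_digraph (with_proj G)"
    using pd by (simp add: wf_digraph_wp_iff pair_digraph_def pair_fin_digraph_def)
  have "\<phi> (f (x, T, p)) = colour_of p" if "(x, T, p) \<in> R {}" for x T p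
    unfolding \<phi>_def by (simp add: inv_into_f_f[OF inj that])
  then have "same_literal_form (placement_opts R) {} X \<longleftrightarrow>
      same_literal_form (digraph_opts \<phi>) (with_proj G) X" for X
    using placement_game_initial[OF pg] step
    by (intro placement_digraph_same_literal_form[where f = f, OF wf]) (auto simp: G_def)
  then show ?thesis
    using pd by blast
qed

lemma digraph_imp_conflict_placement_game:
  fixes G :: "('v, 'a) pre_digraph" and \<phi> :: "'v \<Rightarrow> colour"
  assumes "wf_digraph G" and fin: "finite (verts G)"
  shows "\<exists>R :: ('l :: infinite, 't) ruleset. conflict_placement_game R \<and>
    (\<forall>X. same_literal_form (digraph_opts \<phi>) G X \<longrightarrow>
         same_literal_form (placement_opts R) {} X)"
proof -
  obtain g :: "'v \<Rightarrow> 'l" where g: "inj_on g (verts G)"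
    using finite_inj_on_infinite[OF fin] by blast
  define owner where "owner v = (case \<phi> v of Blue \<Rightarrow> Left | Red \<Rightarrow> Right)" for v
  \<comment> \<open>The location alone identifies the vertex, so one arbitrary piece type serves for
    all moves; the owner is dictated by the colour.\<close>
  define enc :: "'v \<Rightarrow> ('l, 't) move" where "enc v = (g v, undefined, owner v)" for v
  define f where "f = inv_into (verts G) enc"
  define A where
    "A m = enc ` {u \<in> verts G. f m \<in> closed_out_nbhd G u}" for m
  \<comment> \<open>The conflict rule is imposed on all positions, reachable or not, which makes
    \<open>R\<close> antitone outright.\<close>
  define R where "R Y = {m \<in> enc ` verts G. A m \<inter> Y = {}}" for Y
  have inj: "inj_on enc (verts G)"
    using g by (auto simp: inj_on_def enc_def)
  have f_enc: "f (enc v) = v" if "v \<in> verts G" for v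
    unfolding f_def using inv_into_f_f[OF inj that] .
  have R0: "R {} = enc ` verts G"
    unfolding R_def by simp
  have self: "m \<in> A m" if "m \<in> enc ` verts G" for m
    using that f_enc unfolding A_def closed_out_nbhd_def by force
  have pg: "placement_game R"
  proof (rule antimono_placement_game)
    show "antimono R"
      unfolding R_def by (rule antimonoI) blast
    show "R Y \<inter> Y = {}" for Y
      unfolding R_def using self by blast
    show "finite (R {})"
      unfolding R0 using fin by simp
  qed
  have "conflict_placement_game R"
    unfolding conflict_placement_game_def moves_placement_game[OF pg]
  proof (intro conjI ballI)
    fix m assume m: "m \<in> R {}"
    have "A m \<subseteq> R {}"
      unfolding R0 A_def by blast
    moreover have "m \<in> R Y \<longleftrightarrow> (\<exists>ms. leads R {} ms Y \<and> A m \<inter> set ms = {})"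
      if "follower R Y" for Y
      unfolding follower_disjoint_iff[OF that] using m by (auto simp: R_def)
    ultimately show "\<exists>A \<subseteq> R {}. \<forall>Y. follower R Y \<longrightarrow>
        (m \<in> R Y \<longleftrightarrow> (\<exists>ms. leads R {} ms Y \<and> A \<inter> set ms = {}))"
      by blast
  qed (rule pg)
  moreover have "same_literal_form (placement_opts R) {} X \<longleftrightarrow>
      same_literal_form (digraph_opts \<phi>) G X" for X
  proof (rule placement_digraph_same_literal_form[OF assms(1)])
    show "f ` R {} = verts G"
      unfolding R0 using f_enc by force
    show "\<phi> (f (x, T, p)) = colour_of p" if "(x, T, p) \<in> R {}" for x T p
    proof -
      obtain v where v: "v \<in> verts G" "(x, T, p) = enc v"
        using \<open>(x, T, p) \<in> R {}\<close> unfolding R0 by blast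
      then have "p = owner v"
        unfolding enc_def by simp
      then show ?thesis
        using v f_enc by (cases "\<phi> v") (auto simp: owner_def)
    qed
    show "R Y \<subseteq> R {}" for Y
      unfolding R_def by blast
    show "f ` R (insert m Y) = f ` R Y - closed_out_nbhd G (f m)" if "m \<in> R Y" for Y m
    proof -
      obtain v where v: "v \<in> verts G" "m = enc v"
        using \<open>m \<in> R Y\<close> unfolding R_def by blast
      \<comment> \<open>In-neighbourhoods turn into out-neighbourhoods: \<open>m\<close> blocks
        \<open>m'\<close> iff the vertex of \<open>m\<close> deletes that of
        \<open>m'\<close>.\<close>
      have "m \<in> A m' \<longleftrightarrow> f m' \<in> closed_out_nbhd G (f m)" for m'
        unfolding A_def using v f_enc inj_onD[OF inj] by auto
      then have "R (insert m Y) = {m' \<in> R Y. f m' \<notin> closed_out_nbhd G (f m)}"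
        unfolding R_def by auto
      then show ?thesis
        by auto
    qed
  qed
  ultimately show ?thesis
    by blast
qed

theorem theorem1:
  fixes X :: game
  shows
    "(\<exists>R :: ('l :: infinite, 't) ruleset.
        conflict_placement_game R \<and> same_literal_form (placement_opts R) {} X) \<longleftrightarrow>
     (\<exists>(G :: ('v :: infinite) pair_pre_digraph) \<phi>.
        pair_digraph G \<and> same_literal_form (digraph_opts \<phi>) (with_proj G) X)"
proof
  assume "\<exists>R :: ('l, 't) ruleset.
    conflict_placement_game R \<and> same_literal_form (placement_opts R) {} X"
  then show "\<exists>(G :: 'v pair_pre_digraph) \<phi>.
    pair_digraph G \<and> same_literal_form (digraph_opts \<phi>) (with_proj G) X"
    using conflict_placement_game_imp_digraph by blast
next
  assume "\<exists>(G :: 'v pair_pre_digraph) \<phi>.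
    pair_digraph G \<and> same_literal_form (digraph_opts \<phi>) (with_proj G) X"
  then obtain G :: "'v pair_pre_digraph" and \<phi>
    where G: "pair_digraph G" "same_literal_form (digraph_opts \<phi>) (with_proj G) X"
    by blast
  have "wf_digraph (with_proj G)" "finite (verts (with_proj G))"
    using G(1)
    by (simp_all add: wf_digraph_wp_iff pair_digraph_def pair_fin_digraph_def pair_fin_digraph_axioms_def)
  then show "\<exists>R :: ('l, 't) ruleset.
    conflict_placement_game R \<and> same_literal_form (placement_opts R) {} X"
    using digraph_imp_conflict_placement_game G(2) by blast
qed

end
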